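(* Let $w<\tfrac32$ be the principal's budget, and suppose the joint distribution of the agent's costs $(A,B)$ is the Farlie-Gumbel-Morgenstern (FGM) copula with parameter $\theta\in[-1,1]$, i.e. $$P_\theta(A\le a,\,B\le b)=ab\bigl(1+\theta(1-a)(1-b)\bigr),\qquad a,b\in[0,1].$$ (i) Under the purely sufficient rewarding rule $(x=w,\,y=w,\,z=0)$, the overall performance decreases in $\theta$. (ii) Under the purely sustained rewarding rule $(x=0,\,y=0,\,z=w)$: (a) the overall performance increases in $\theta$ for $w<1$; (b) the overall performance decreases in $\theta$ for $w>1$.
   Context: Two-period principal-agent model. In each of two periods a risk-neutral agent chooses to perform ($P$) or not ($N$). Not performing costs $0$; performing costs $A$ in period 1 and $B$ in period 2. The agent knows the joint distribution of $(A,B)$, privately learns $A$ before the period-1 decision and $B$ only before the period-2 decision. He maximizes expected total reward minus total cost, without discounting, and performs when indifferent. The principal has a total budget $w$ for rewards. A rewarding rule is a triple $(x,y,z)$ of non-negative reals: $x$ is the reward for performing in period 1; $y$ is the reward for performing in period 2 after not performing in period 1; $z$ is the additional reward for performing in period 2 after having performed in period 1. Thus in period 2 the agent performs iff $B\le z$ (if he performed in period 1) or $B\le y$ (if he did not). In period 1, with cost $A=c$, he performs iff $$x-c+E[(z-B)^+\mid A=c]\ \ge\ E[(y-B)^+\mid A=c].$$ The overall performance (level) is the expected total number of periods in which the agent performs. *)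

theory Defs
  imports "HOL-Probability.Probability"
begin

definition fgm_copula :: "real \<Rightarrow> real \<Rightarrow> real \<Rightarrow> real" where
  "fgm_copula \<theta> a b = a * b * (1 + \<theta> * (1 - a) * (1 - b))"

(* The distribution function is prescribed on the unit square only; since it vanishes on the
   lower and left edges and equals 1 at (1,1), this determines the joint law of (A, B). *)
definition fgm_distributed ::
    "'a measure \<Rightarrow> ('a \<Rightarrow> real) \<Rightarrow> ('a \<Rightarrow> real) \<Rightarrow> real \<Rightarrow> bool" where
  "fgm_distributed M A B \<theta> \<longleftrightarrow>
     prob_space M \<and> A \<in> borel_measurable M \<and> B \<in> borel_measurable M \<and>
     (\<forall>a\<in>{0..1}. \<forall>b\<in>{0..1}.
        measure M {\<omega> \<in> space M. A \<omega> \<le> a \<and> B \<omega> \<le> b} = fgm_copula \<theta> a b)"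

(* E[(r - B)^+ | A], i.e. the function c \<mapsto> E[(r - B)^+ | A = c] evaluated at c = A \<omega>.
   It is determined up to a null set, which does not affect the performance level below. *)
definition continuation_value ::
    "'a measure \<Rightarrow> ('a \<Rightarrow> real) \<Rightarrow> ('a \<Rightarrow> real) \<Rightarrow> real \<Rightarrow> 'a \<Rightarrow> real" where
  "continuation_value M A B r =
     real_cond_exp M (vimage_algebra (space M) A borel) (\<lambda>\<omega>. max 0 (r - B \<omega>))"

(* (x, y, z): reward for performing in period 1, reward for performing in period 2 after not
   performing in period 1, additional reward for performing in period 2 after having
   performed in period 1. *)
type_synonym rewarding_rule = "real \<times> real \<times> real"

fun performs1 ::
    "'a measure \<Rightarrow> ('a \<Rightarrow> real) \<Rightarrow> ('a \<Rightarrow> real) \<Rightarrow> rewarding_rule \<Rightarrow> 'a \<Rightarrow> bool" where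
  "performs1 M A B (x, y, z) \<omega> \<longleftrightarrow>
     x - A \<omega> + continuation_value M A B z \<omega> \<ge> continuation_value M A B y \<omega>"

fun performs2 ::
    "'a measure \<Rightarrow> ('a \<Rightarrow> real) \<Rightarrow> ('a \<Rightarrow> real) \<Rightarrow> rewarding_rule \<Rightarrow> 'a \<Rightarrow> bool" where
  "performs2 M A B (x, y, z) \<omega> \<longleftrightarrow>
     (if performs1 M A B (x, y, z) \<omega> then B \<omega> \<le> z else B \<omega> \<le> y)"

definition overall_performance ::
    "'a measure \<Rightarrow> ('a \<Rightarrow> real) \<Rightarrow> ('a \<Rightarrow> real) \<Rightarrow> rewarding_rule \<Rightarrow> real" where
  "overall_performance M A B \<rho> =
     (\<integral>\<omega>. of_bool (performs1 M A B \<rho> \<omega>) + of_bool (performs2 M A B \<rho> \<omega>) \<partial>M)"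

definition purely_sufficient :: "real \<Rightarrow> rewarding_rule" where
  "purely_sufficient w = (w, w, 0)"

definition purely_sustained :: "real \<Rightarrow> rewarding_rule" where
  "purely_sustained w = (0, 0, w)"

end

theory Submission
  imports Defs
begin

text \<open>
  Write \<open>C\<^sub>\<theta>\<close> for the copula. On the unit square it has the density
  \<open>1 + \<theta> (1 - 2a) (1 - 2b)\<close>, which depends on the first cost only through an affine factor.
  Hence the value of a period-2 reward \<open>r\<close> after observing the cost \<open>a\<close> is affine in \<open>a\<close>,
  namely \<open>g(r) + \<theta> (1 - 2a) h(r)\<close>, where \<open>g\<close> is the expected surplus \<open>E[(r - U)\<^sup>+]\<close> for a
  uniform cost \<open>U\<close> and \<open>h(r) = E[(r - U)\<^sup>+ (1 - 2U)]\<close> lies between \<open>0\<close> and \<open>1/6\<close>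
  (\<open>continuation_value_fgm\<close>). So under a rule \<open>(x, y, z)\<close> the agent performs in period 1 iff his
  cost is at most
    \<open>t = 1/2 + (x + g(z) - g(y) - 1/2) / (1 + 2\<theta> (h(z) - h(y)))\<close>.
  Only the denominator depends on \<open>\<theta>\<close>, so the direction in which \<open>t\<close> moves is read off
  from the signs of \<open>x + g(z) - g(y) - 1/2\<close> and \<open>h(z) - h(y)\<close>.

  With \<open>t\<close> and all rewards clamped to the unit interval, the overall performance is
  \<open>t + y + C\<^sub>\<theta>(t, z) - C\<^sub>\<theta>(t, y)\<close> (\<open>overall_performance_fgm\<close>). The copula is monotone and
  nonexpansive in its first argument and monotone in \<open>\<theta>\<close>, which settles the three claims:

  \<^item> Sufficient rule: the performance is \<open>w + t - C\<^sub>\<theta>(t, w)\<close>. Here \<open>w - g(w) - 1/2\<close> is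
    \<open>-(1 - w)\<^sup>2 / 2\<close> for \<open>w \<le> 1\<close> and vanishes beyond, so \<open>t\<close> decreases; then \<open>t - C\<^sub>\<theta>(t, w)\<close>
    decreases because of \<open>t\<close> and because of \<open>\<theta>\<close>.
  \<^item> Sustained rule, \<open>w < 1\<close>: the performance is \<open>t + C\<^sub>\<theta>(t, w)\<close>. Since \<open>g(w) \<le> 1/2\<close>, the
    threshold increases, and the copula increases in both \<open>t\<close> and \<open>\<theta>\<close>.
  \<^item> Sustained rule, \<open>w > 1\<close>: everyone who performs in period 1 performs again, so the
    performance is \<open>2t\<close>; now \<open>g(w) > 1/2\<close> and the threshold decreases.
\<close>

section \<open>Monotonicity of the copula\<close>

definition clamp01 :: "real \<Rightarrow> real" where
  "clamp01 t = max 0 (min 1 t)"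

lemma clamp01_bounds [simp]: "0 \<le> clamp01 t" "clamp01 t \<le> 1"
  and clamp01_mono: "s \<le> t \<Longrightarrow> clamp01 s \<le> clamp01 t"
  by (auto simp: clamp01_def)

lemma abs_fgm_weight_le_1:
  fixes \<theta> u v :: real
  assumes "\<bar>\<theta>\<bar> \<le> 1" "\<bar>u\<bar> \<le> 1" "\<bar>v\<bar> \<le> 1"
  shows "\<bar>\<theta> * u * v\<bar> \<le> 1"
  using assms by (simp add: abs_mult mult_le_one)

text \<open>
  Both estimates in the first argument hold because the increment of the quadratic
  \<open>a \<mapsto> C\<^sub>\<theta>(a, b)\<close> factors, leaving a factor of the form \<open>1 \<plusminus> \<theta> u v\<close> with \<open>u\<close> and \<open>v\<close> of absolute
  value at most \<open>1\<close>.
\<close>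
lemma fgm_copula_mono_arg:
  assumes "\<bar>\<theta>\<bar> \<le> 1" "0 \<le> a" "a \<le> a'" "a' \<le> 1" "0 \<le> b" "b \<le> 1"
  shows "fgm_copula \<theta> a b \<le> fgm_copula \<theta> a' b"
proof -
  have "fgm_copula \<theta> a' b - fgm_copula \<theta> a b = (a' - a) * b * (1 + \<theta> * (1 - a - a') * (1 - b))"
    by (simp add: fgm_copula_def algebra_simps)
  moreover have "\<bar>\<theta> * (1 - a - a') * (1 - b)\<bar> \<le> 1"
    using assms by (intro abs_fgm_weight_le_1) auto
  ultimately show ?thesis
    using assms by (smt (verit) mult_nonneg_nonneg)
qed

lemma fgm_copula_nonexpansive_arg:
  assumes "\<bar>\<theta>\<bar> \<le> 1" "0 \<le> a" "a \<le> a'" "a' \<le> 1" "0 \<le> b" "b \<le> 1"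
  shows "fgm_copula \<theta> a' b - fgm_copula \<theta> a b \<le> a' - a"
proof -
  have "(a' - a) - (fgm_copula \<theta> a' b - fgm_copula \<theta> a b) =
      (a' - a) * (1 - b) * (1 - \<theta> * (1 - a - a') * b)"
    by (simp add: fgm_copula_def algebra_simps)
  moreover have "\<bar>\<theta> * (1 - a - a') * b\<bar> \<le> 1"
    using assms by (intro abs_fgm_weight_le_1) auto
  ultimately show ?thesis
    using assms by (smt (verit) mult_nonneg_nonneg)
qed

lemma fgm_copula_mono_param:
  assumes "\<theta> \<le> \<theta>'" "0 \<le> a" "a \<le> 1" "0 \<le> b" "b \<le> 1"
  shows "fgm_copula \<theta> a b \<le> fgm_copula \<theta>' a b"
  unfolding fgm_copula_def using assms by (intro mult_left_mono add_left_mono mult_right_mono) auto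

section \<open>The joint law and its density\<close>

text \<open>
  The values of the copula at \<open>(1, 1)\<close>, \<open>(0, 1)\<close> and \<open>(1, 0)\<close> confine the costs to the unit
  square and rule out zero costs, so that a reward of \<open>0\<close> never induces performance.
\<close>
lemma fgm_distributed_AE_unit:
  assumes "fgm_distributed M A B \<theta>"
  shows "AE \<omega> in M. 0 < A \<omega> \<and> A \<omega> \<le> 1 \<and> 0 < B \<omega> \<and> B \<omega> \<le> 1"
proof -
  from assms interpret prob_space M by (simp add: fgm_distributed_def)
  have [measurable]: "A \<in> borel_measurable M" "B \<in> borel_measurable M"
    using assms by (auto simp: fgm_distributed_def)
  have cdf: "prob {\<omega> \<in> space M. A \<omega> \<le> a \<and> B \<omega> \<le> b} = fgm_copula \<theta> a b"
    if "a \<in> {0..1}" "b \<in> {0..1}" for a b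
    using assms that by (auto simp: fgm_distributed_def)
  have "AE \<omega> in M. A \<omega> \<le> 1 \<and> B \<omega> \<le> 1"
    using cdf[of 1 1] by (subst prob_Collect_eq_1[symmetric]) (auto simp: fgm_copula_def)
  moreover have "AE \<omega> in M. \<not> (A \<omega> \<le> 0 \<and> B \<omega> \<le> 1)"
    using cdf[of 0 1] by (subst prob_Collect_eq_0[symmetric]) (auto simp: fgm_copula_def)
  moreover have "AE \<omega> in M. \<not> (A \<omega> \<le> 1 \<and> B \<omega> \<le> 0)"
    using cdf[of 1 0] by (subst prob_Collect_eq_0[symmetric]) (auto simp: fgm_copula_def)
  ultimately show ?thesis by eventually_elim auto
qed

lemma fgm_distributed_cdf:
  assumes "fgm_distributed M A B \<theta>"
  shows "measure M {\<omega> \<in> space M. A \<omega> \<le> a \<and> B \<omega> \<le> b} = fgm_copula \<theta> (clamp01 a) (clamp01 b)"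
proof -
  from assms interpret prob_space M by (simp add: fgm_distributed_def)
  have [measurable]: "A \<in> borel_measurable M" "B \<in> borel_measurable M"
    using assms by (auto simp: fgm_distributed_def)
  have "measure M {\<omega> \<in> space M. A \<omega> \<le> a \<and> B \<omega> \<le> b} =
      measure M {\<omega> \<in> space M. A \<omega> \<le> clamp01 a \<and> B \<omega> \<le> clamp01 b}"
    using fgm_distributed_AE_unit[OF assms]
    by (intro measure_eq_AE) (auto simp: clamp01_def)
  also have "\<dots> = fgm_copula \<theta> (clamp01 a) (clamp01 b)"
    using assms by (auto simp: fgm_distributed_def)
  finally show ?thesis .
qed

text \<open>
  By the clamped form of the distribution function both laws agree on all lower orthants,
  and these are an intersection-stable generator of the Borel sets of the plane.
\<close>
lemma fgm_joint_law_unique: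
  assumes "fgm_distributed M A B \<theta>" "fgm_distributed N A' B' \<theta>"
  shows "distr M (borel \<Otimes>\<^sub>M borel) (\<lambda>\<omega>. (A \<omega>, B \<omega>)) = distr N (borel \<Otimes>\<^sub>M borel) (\<lambda>\<omega>. (A' \<omega>, B' \<omega>))"
    (is "?L = ?R")
proof -
  interpret M: prob_space M using assms by (simp add: fgm_distributed_def)
  interpret N: prob_space N using assms by (simp add: fgm_distributed_def)
  have [measurable]: "A \<in> borel_measurable M" "B \<in> borel_measurable M"
      "A' \<in> borel_measurable N" "B' \<in> borel_measurable N"
    using assms by (auto simp: fgm_distributed_def)
  have sets: "sets (borel \<Otimes>\<^sub>M borel) = sigma_sets UNIV (range (\<lambda>p::real \<times> real. {..p}))"
    unfolding borel_prod by (subst borel_eq_atMost) simp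
  have emeas: "emeasure ?L {..p} = fgm_copula \<theta> (clamp01 (fst p)) (clamp01 (snd p))"
              "emeasure ?R {..p} = fgm_copula \<theta> (clamp01 (fst p)) (clamp01 (snd p))" for p
  proof -
    have [measurable]: "{..p} \<in> sets (borel \<Otimes>\<^sub>M borel)" unfolding borel_prod by simp
    have "(\<lambda>\<omega>. (A \<omega>, B \<omega>)) -` {..p} \<inter> space M = {\<omega> \<in> space M. A \<omega> \<le> fst p \<and> B \<omega> \<le> snd p}"
         "(\<lambda>\<omega>. (A' \<omega>, B' \<omega>)) -` {..p} \<inter> space N = {\<omega> \<in> space N. A' \<omega> \<le> fst p \<and> B' \<omega> \<le> snd p}"
      by (auto simp: less_eq_prod_def)
    then show "emeasure ?L {..p} = fgm_copula \<theta> (clamp01 (fst p)) (clamp01 (snd p))"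
              "emeasure ?R {..p} = fgm_copula \<theta> (clamp01 (fst p)) (clamp01 (snd p))"
      by (simp_all add: emeasure_distr M.emeasure_eq_measure N.emeasure_eq_measure
          fgm_distributed_cdf[OF assms(1)] fgm_distributed_cdf[OF assms(2)])
  qed
  show ?thesis
  proof (rule measure_eqI_generator_eq)
    show "Int_stable (range (\<lambda>p::real \<times> real. {..p}))"
    proof -
      have "{..p} \<inter> {..q} = {..(min (fst p) (fst q), min (snd p) (snd q))}" for p q :: "real \<times> real"
        by (auto simp: less_eq_prod_def)
      then show ?thesis by (auto simp: Int_stable_def)
    qed
    show "range (\<lambda>n::nat. {..(real n, real n)}) \<subseteq> range (\<lambda>p. {..p})" by auto
    show "(\<Union>n. {..(real n, real n)}) = UNIV"
    proof -
      have "\<exists>n. p \<le> (real n, real n)" for p :: "real \<times> real"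
        using real_arch_simple[of "max (fst p) (snd p)"] by (auto simp: less_eq_prod_def)
      then show ?thesis by auto
    qed
  qed (auto simp: emeas sets)
qed

definition fgm_density :: "real \<Rightarrow> real \<times> real \<Rightarrow> real" where
  "fgm_density \<theta> = (\<lambda>(a, b). indicator {0..1} a * (indicator {0..1} b * (1 + \<theta> * (1 - 2 * a) * (1 - 2 * b))))"

lemma fgm_density_measurable [measurable]: "fgm_density \<theta> \<in> borel_measurable (borel \<Otimes>\<^sub>M borel)"
  unfolding fgm_density_def by measurable

lemma fgm_density_nonneg:
  assumes "\<bar>\<theta>\<bar> \<le> 1"
  shows "0 \<le> fgm_density \<theta> p"
proof (cases "fst p \<in> {0..1} \<and> snd p \<in> {0..1}")
  case True
  then have "\<bar>\<theta> * (1 - 2 * fst p) * (1 - 2 * snd p)\<bar> \<le> 1"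
    using assms by (intro abs_fgm_weight_le_1) auto
  then show ?thesis by (auto simp: fgm_density_def indicator_def split: prod.splits)
qed (auto simp: fgm_density_def split: prod.splits)

text \<open>
  Integrating the density over \<open>[0, b]\<close> and then over \<open>[0, a]\<close> gives back the copula, because
  \<open>1 - 2v\<close> has the antiderivative \<open>v - v\<^sup>2 = v (1 - v)\<close>.
\<close>
lemma nn_integral_fgm_density_box:
  assumes "\<bar>\<theta>\<bar> \<le> 1" "0 \<le> a" "a \<le> 1" "0 \<le> b" "b \<le> 1"
  shows "(\<integral>\<^sup>+ p. ennreal (fgm_density \<theta> p) * indicator ({..a} \<times> {..b}) p \<partial>(lborel \<Otimes>\<^sub>M lborel)) =
    ennreal (fgm_copula \<theta> a b)"
proof -
  have w: "\<bar>\<theta> * (1 - 2 * u) * v\<bar> \<le> 1" if "0 \<le> u" "u \<le> 1" "\<bar>v\<bar> \<le> 1" for u v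
    using that assms by (intro abs_fgm_weight_le_1) auto
  let ?G = "\<lambda>u. b + \<theta> * (1 - 2 * u) * (b - b^2)"
  have inner: "(\<integral>\<^sup>+ v. ennreal (fgm_density \<theta> (u, v)) * indicator ({..a} \<times> {..b}) (u, v) \<partial>lborel) =
      ennreal (?G u) * indicator {0..a} u" for u
  proof (cases "u \<in> {0..a}")
    case True
    have "(\<integral>\<^sup>+ v. ennreal (fgm_density \<theta> (u, v)) * indicator ({..a} \<times> {..b}) (u, v) \<partial>lborel) =
        (\<integral>\<^sup>+ v. ennreal (1 + \<theta> * (1 - 2 * u) * (1 - 2 * v)) * indicator {0..b} v \<partial>lborel)"
      using True assms by (intro nn_integral_cong) (auto simp: fgm_density_def indicator_def)
    also have "\<dots> = ennreal (?G u - (0 + \<theta> * (1 - 2 * u) * (0 - 0^2)))"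
    proof (rule nn_integral_FTC_Icc[where F = "\<lambda>v. v + \<theta> * (1 - 2 * u) * (v - v^2)"])
      fix v assume v: "v \<in> {0..b}"
      show "((\<lambda>v. v + \<theta> * (1 - 2 * u) * (v - v^2)) has_real_derivative
          1 + \<theta> * (1 - 2 * u) * (1 - 2 * v)) (at v)"
        by (auto intro!: derivative_eq_intros)
      show "0 \<le> 1 + \<theta> * (1 - 2 * u) * (1 - 2 * v)"
        using v True assms w[of u "1 - 2 * v"] by (auto simp: abs_le_iff)
    qed (use assms in auto)
    finally show ?thesis using True by simp
  next
    case False
    then have zero: "ennreal (fgm_density \<theta> (u, v)) * indicator ({..a} \<times> {..b}) (u, v) = 0" for v
      by (auto simp: fgm_density_def indicator_def)
    show ?thesis unfolding zero using False by simp
  qed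
  have "(\<integral>\<^sup>+ p. ennreal (fgm_density \<theta> p) * indicator ({..a} \<times> {..b}) p \<partial>(lborel \<Otimes>\<^sub>M lborel)) =
      (\<integral>\<^sup>+ u. ennreal (?G u) * indicator {0..a} u \<partial>lborel)"
    by (subst lborel.nn_integral_fst[symmetric]) (simp_all only: inner, measurable)
  also have "\<dots> = ennreal ((b * a + \<theta> * (a - a^2) * (b - b^2)) - (b * 0 + \<theta> * (0 - 0^2) * (b - b^2)))"
  proof (rule nn_integral_FTC_Icc[where F = "\<lambda>u. b * u + \<theta> * (u - u^2) * (b - b^2)"])
    fix u assume u: "u \<in> {0..a}"
    show "((\<lambda>u. b * u + \<theta> * (u - u^2) * (b - b^2)) has_real_derivative ?G u) (at u)"
      by (auto intro!: derivative_eq_intros)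
    have "?G u = b * (1 + \<theta> * (1 - 2 * u) * (1 - b))"
      by (simp add: algebra_simps power2_eq_square)
    then show "0 \<le> ?G u"
      using u assms w[of u "1 - b"] by auto
  qed (use assms in auto)
  also have "(b * a + \<theta> * (a - a^2) * (b - b^2)) - (b * 0 + \<theta> * (0 - 0^2) * (b - b^2)) = fgm_copula \<theta> a b"
    by (simp add: fgm_copula_def algebra_simps power2_eq_square)
  finally show ?thesis .
qed

text \<open>
  The coordinates under the density are an instance of the distribution; uniqueness of the joint
  law then carries every computation with the density over to arbitrary \<open>A\<close> and \<open>B\<close>.
\<close>
lemma fgm_distributed_density:
  assumes "\<bar>\<theta>\<bar> \<le> 1"
  shows "fgm_distributed (density (lborel \<Otimes>\<^sub>M lborel) (fgm_density \<theta>)) fst snd \<theta>"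
    (is "fgm_distributed ?D _ _ _")
proof -
  have box: "emeasure ?D ({..a} \<times> {..b}) = fgm_copula \<theta> a b" if "a \<in> {0..1}" "b \<in> {0..1}" for a b
    using that assms nn_integral_fgm_density_box[of \<theta> a b]
    by (subst emeasure_density) auto
  have "emeasure ?D (space ?D) = emeasure ?D ({..1} \<times> {..1})"
  proof (rule emeasure_eq_AE)
    show "AE p in ?D. p \<in> space ?D \<longleftrightarrow> p \<in> {..1} \<times> {..1}"
      by (subst AE_density) (auto intro!: AE_I2 simp: fgm_density_def space_pair_measure indicator_def
          split: prod.splits if_splits)
    show "space ?D \<in> sets ?D" by (rule sets.top)
    show "{..1} \<times> {..1} \<in> sets ?D" by (simp add: pair_measureI)
  qed
  also have "\<dots> = 1" using box[of 1 1] by (simp add: fgm_copula_def)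
  finally have "prob_space ?D" by (rule prob_spaceI)
  moreover have "measure ?D {p \<in> space ?D. fst p \<le> a \<and> snd p \<le> b} = fgm_copula \<theta> a b"
    if "a \<in> {0..1}" "b \<in> {0..1}" for a b
  proof -
    have "{p \<in> space ?D. fst p \<le> a \<and> snd p \<le> b} = {..a} \<times> {..b}"
      by (auto simp: space_pair_measure)
    moreover have "0 \<le> fgm_copula \<theta> a b"
      using that assms fgm_copula_mono_arg[of \<theta> 0 a b] by (simp add: fgm_copula_def)
    ultimately show ?thesis using box[OF that] by (simp add: measure_def)
  qed
  ultimately show ?thesis by (simp add: fgm_distributed_def)
qed

lemma fgm_integral_eq:
  fixes u :: "real \<times> real \<Rightarrow> real"
  assumes fgm: "fgm_distributed M A B \<theta>" and "\<bar>\<theta>\<bar> \<le> 1"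
    and [measurable]: "u \<in> borel_measurable (borel \<Otimes>\<^sub>M borel)"
    and int: "integrable M (\<lambda>\<omega>. u (A \<omega>, B \<omega>))"
  shows "(\<integral>\<omega>. u (A \<omega>, B \<omega>) \<partial>M) =
    (\<integral>a. indicator {0..1} a *
      (\<integral>b. indicator {0..1} b * ((1 + \<theta> * (1 - 2 * a) * (1 - 2 * b)) * u (a, b)) \<partial>lborel) \<partial>lborel)"
proof -
  have [measurable]: "A \<in> borel_measurable M" "B \<in> borel_measurable M"
    using fgm by (auto simp: fgm_distributed_def)
  let ?D = "density (lborel \<Otimes>\<^sub>M lborel) (fgm_density \<theta>)"
  have nonneg: "0 \<le> fgm_density \<theta> p" for p by (rule fgm_density_nonneg) fact
  have "distr ?D (borel \<Otimes>\<^sub>M borel) (\<lambda>p. (fst p, snd p)) = distr ?D ?D (\<lambda>p. p)"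
    by (rule distr_cong) auto
  then have law: "distr M (borel \<Otimes>\<^sub>M borel) (\<lambda>\<omega>. (A \<omega>, B \<omega>)) = ?D"
    using fgm_joint_law_unique[OF fgm fgm_distributed_density[OF assms(2)]] by simp
  have "integrable ?D u"
    using int unfolding law[symmetric] by (subst integrable_distr_eq) auto
  then have "integrable (lborel \<Otimes>\<^sub>M lborel) (\<lambda>p. fgm_density \<theta> p * u p)"
    by (subst (asm) integrable_density) (auto simp: nonneg)
  then have fub: "(\<integral>p. fgm_density \<theta> p * u p \<partial>(lborel \<Otimes>\<^sub>M lborel)) =
      (\<integral>a. \<integral>b. fgm_density \<theta> (a, b) * u (a, b) \<partial>lborel \<partial>lborel)"
    by (rule lborel_pair.integral_fst'[symmetric])
  have "(\<integral>\<omega>. u (A \<omega>, B \<omega>) \<partial>M) = (\<integral>p. u p \<partial>?D)"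
    unfolding law[symmetric] by (subst integral_distr) auto
  also have "\<dots> = (\<integral>p. fgm_density \<theta> p * u p \<partial>(lborel \<Otimes>\<^sub>M lborel))"
    by (subst integral_density) (auto simp: nonneg)
  finally show ?thesis
    unfolding fub by (simp add: fgm_density_def mult.assoc)
qed

section \<open>The continuation value\<close>

text \<open>The value \<open>E[(r - U)\<^sup>+]\<close> for \<open>U\<close> uniform on the unit interval and \<open>r \<ge> 0\<close>.\<close>
definition surplus_mean :: "real \<Rightarrow> real" where
  "surplus_mean r = (if r \<le> 1 then r^2 / 2 else r - 1 / 2)"

text \<open>The value \<open>E[(r - U)\<^sup>+ (1 - 2U)]\<close> for \<open>U\<close> uniform on the unit interval and \<open>r \<ge> 0\<close>.\<close>
definition surplus_tilt :: "real \<Rightarrow> real" where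
  "surplus_tilt r = (if r \<le> 1 then r^2 / 2 - r^3 / 3 else 1 / 6)"

text \<open>
  Given a period-1 cost \<open>a\<close>, the period-2 cost has the density \<open>1 + \<kappa> (1 - 2b)\<close> with
  \<open>\<kappa> = \<theta> (1 - 2a)\<close>.
\<close>
lemma conditional_surplus:
  assumes "0 \<le> r"
  shows "(\<integral>b. indicator {0..1} b * ((1 + \<kappa> * (1 - 2 * b)) * max 0 (r - b)) \<partial>lborel) =
    surplus_mean r + \<kappa> * surplus_tilt r"
proof -
  define m where "m = min r 1"
  let ?F = "\<lambda>b. r * b - b^2 / 2 + \<kappa> * (r * b - b^2 / 2 - r * b^2 + 2 * b^3 / 3)"
  have "(\<integral>b. indicator {0..1} b * ((1 + \<kappa> * (1 - 2 * b)) * max 0 (r - b)) \<partial>lborel) =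
      (\<integral>b. ((1 + \<kappa> * (1 - 2 * b)) * (r - b)) * indicator {0..m} b \<partial>lborel)"
    by (intro Bochner_Integration.integral_cong) (auto simp: indicator_def m_def)
  also have "\<dots> = ?F m - ?F 0"
    using assms by (intro integral_FTC_Icc_real)
      (auto simp: m_def field_simps power2_eq_square intro!: derivative_eq_intros)
  finally show ?thesis by (auto simp: surplus_mean_def surplus_tilt_def m_def min_def field_simps power2_eq_square power3_eq_cube)
qed

text \<open>The conditional density integrates to \<open>1\<close>, so functions of the first cost alone pass through.\<close>
lemma conditional_total_mass:
  "(\<integral>b. indicator {0..1} b * ((1 + \<kappa> * (1 - 2 * b)) * c) \<partial>lborel) = (c::real)"
proof -
  have "(\<integral>b. (1 + \<kappa> * (1 - 2 * b)) * c * indicator {0..1} b \<partial>lborel) =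
      (1 + \<kappa> * (1 - 1^2)) * c - (0 + \<kappa> * (0 - 0^2)) * c"
    by (intro integral_FTC_Icc_real) (auto simp: field_simps intro!: derivative_eq_intros)
  then show ?thesis by (simp add: mult_ac)
qed

text \<open>
  The conditional expectation is characterised by its integrals over the events \<open>A \<in> T\<close>. Over such
  an event, integrating out the second cost against the density turns both sides into the integral
  of the same function over \<open>T \<inter> [0, 1]\<close>.
\<close>
lemma continuation_value_fgm:
  assumes fgm: "fgm_distributed M A B \<theta>" and \<theta>: "\<bar>\<theta>\<bar> \<le> 1" and r: "0 \<le> r"
  shows "AE \<omega> in M. continuation_value M A B r \<omega> =
    surplus_mean r + \<theta> * (1 - 2 * A \<omega>) * surplus_tilt r"
proof -
  from fgm interpret prob_space M by (simp add: fgm_distributed_def)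
  have [measurable]: "A \<in> borel_measurable M" "B \<in> borel_measurable M"
    using fgm by (auto simp: fgm_distributed_def)
  let ?F = "vimage_algebra (space M) A borel"
  let ?G = "\<lambda>a. surplus_mean r + \<theta> * (1 - 2 * a) * surplus_tilt r"
  have "subalgebra M ?F"
    by (auto simp: subalgebra_def sets_vimage_algebra2)
  then interpret finite_measure_subalgebra M ?F
    by unfold_locales
  note unit = fgm_distributed_AE_unit[OF fgm]
  have intB: "integrable M (\<lambda>\<omega>. max 0 (r - B \<omega>))"
  proof (rule integrable_const_bound[of _ r])
    show "AE \<omega> in M. norm (max 0 (r - B \<omega>)) \<le> r"
      using unit by eventually_elim (use r in auto)
  qed measurable
  have intG: "integrable M (\<lambda>\<omega>. ?G (A \<omega>))"
  proof -
    have "integrable M A"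
    proof (rule integrable_const_bound[of _ 1])
      show "AE \<omega> in M. norm (A \<omega>) \<le> 1"
        using unit by eventually_elim auto
    qed measurable
    then show ?thesis by auto
  qed
  have [measurable]: "A \<in> borel_measurable ?F"
    by (rule measurable_vimage_algebra1) auto
  show ?thesis
    unfolding continuation_value_def
  proof (rule real_cond_exp_charact)
    fix S assume "S \<in> sets ?F"
    then obtain T where T [measurable]: "T \<in> sets borel" and S: "S = A -` T \<inter> space M"
      by (auto simp: sets_vimage_algebra2)
    have intBT: "integrable M (\<lambda>\<omega>. indicator T (A \<omega>) * max 0 (r - B \<omega>))"
      using integrable_mult_indicator[OF _ intB, of "A -` T \<inter> space M"]
      by (rule Bochner_Integration.integrable_cong[THEN iffD1, rotated 2]) (auto simp: indicator_def)
    have intGT: "integrable M (\<lambda>\<omega>. indicator T (A \<omega>) * ?G (A \<omega>))"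
      using integrable_mult_indicator[OF _ intG, of "A -` T \<inter> space M"]
      by (rule Bochner_Integration.integrable_cong[THEN iffD1, rotated 2]) (auto simp: indicator_def)
    have "(\<integral>\<omega>. indicator T (A \<omega>) * max 0 (r - B \<omega>) \<partial>M) =
        (\<integral>a. indicator {0..1} a * (indicator T a * ?G a) \<partial>lborel)"
      using fgm_integral_eq[OF fgm \<theta>, of "\<lambda>p. indicator T (fst p) * max 0 (r - snd p)"] intBT
      by (simp add: mult.left_commute[of _ "indicator T _"] conditional_surplus[OF r])
    also have "\<dots> = (\<integral>\<omega>. indicator T (A \<omega>) * ?G (A \<omega>) \<partial>M)"
      using fgm_integral_eq[OF fgm \<theta>, of "\<lambda>p. indicator T (fst p) * ?G (fst p)"] intGT
      by (simp add: conditional_total_mass)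
    finally show "(\<integral>\<omega>\<in>S. max 0 (r - B \<omega>) \<partial>M) = (\<integral>\<omega>\<in>S. ?G (A \<omega>) \<partial>M)"
      unfolding S set_lebesgue_integral_def
      by (simp add: indicator_def cong: Bochner_Integration.integral_cong)
  qed (use intB intG in auto)
qed

section \<open>The first-period threshold and the overall performance\<close>
lemma surplus_tilt_bounds:
  assumes "0 \<le> r"
  shows "0 \<le> surplus_tilt r" "surplus_tilt r \<le> 1 / 6"
proof -
  have "0 \<le> r^2 / 2 - r^3 / 3" "r^2 / 2 - r^3 / 3 \<le> 1 / 6" if "r \<le> 1"
  proof -
    \<comment> \<open>The maximum \<open>1/6\<close> is attained at the critical point \<open>r = 1\<close>, hence the double root there.\<close>
    have "r^2 / 2 - r^3 / 3 = r^2 * (3 - 2 * r) / 6"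
      "1 / 6 - (r^2 / 2 - r^3 / 3) = (1 - r)^2 * (1 + 2 * r) / 6"
      by (auto simp: field_simps power2_eq_square power3_eq_cube)
    moreover have "0 \<le> r^2 * (3 - 2 * r)" "0 \<le> (1 - r)^2 * (1 + 2 * r)"
      using assms that by auto
    ultimately show "0 \<le> r^2 / 2 - r^3 / 3" "r^2 / 2 - r^3 / 3 \<le> 1 / 6" by linarith+
  qed
  then show "0 \<le> surplus_tilt r" "surplus_tilt r \<le> 1 / 6"
    by (auto simp: surplus_tilt_def)
qed

text \<open>
  Centring the cost at \<open>1/2\<close> makes the numerator free of \<open>\<theta>\<close>: the continuation values contribute
  \<open>1 - 2a = -2 (a - 1/2)\<close>, so \<open>\<theta>\<close> enters the indifference condition only through the slope in
  \<open>a - 1/2\<close>. The value may lie outside the unit interval.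
\<close>
definition cost_threshold :: "real \<Rightarrow> rewarding_rule \<Rightarrow> real" where
  "cost_threshold \<theta> = (\<lambda>(x, y, z). 1 / 2 +
     (x + surplus_mean z - surplus_mean y - 1 / 2) / (1 + 2 * \<theta> * (surplus_tilt z - surplus_tilt y)))"

lemma cost_threshold_denominator_pos:
  assumes "\<bar>\<theta>\<bar> \<le> 1" "0 \<le> y" "0 \<le> z"
  shows "0 < 1 + 2 * \<theta> * (surplus_tilt z - surplus_tilt y)"
proof -
  have "\<bar>\<theta> * (surplus_tilt z - surplus_tilt y) * 1\<bar> \<le> 1 * (1 / 6) * 1"
    unfolding abs_mult using assms surplus_tilt_bounds[of y] surplus_tilt_bounds[of z]
    by (intro mult_mono) linarith+
  then show ?thesis by linarith
qed

lemma performs1_iff_cost_threshold: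
  assumes fgm: "fgm_distributed M A B \<theta>" and \<theta>: "\<bar>\<theta>\<bar> \<le> 1" and yz: "0 \<le> y" "0 \<le> z"
  shows "AE \<omega> in M. performs1 M A B (x, y, z) \<omega> \<longleftrightarrow> A \<omega> \<le> cost_threshold \<theta> (x, y, z)"
  using continuation_value_fgm[OF fgm \<theta> yz(1)] continuation_value_fgm[OF fgm \<theta> yz(2)]
proof eventually_elim
  case (elim \<omega>)
  define G where "G = surplus_mean z - surplus_mean y"
  define H where "H = surplus_tilt z - surplus_tilt y"
  have pos: "0 < 1 + 2 * \<theta> * H"
    unfolding H_def by (rule cost_threshold_denominator_pos) fact+
  have "performs1 M A B (x, y, z) \<omega> \<longleftrightarrow> (A \<omega> - 1 / 2) * (1 + 2 * \<theta> * H) \<le> x + G - 1 / 2"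
    by (simp add: elim G_def H_def algebra_simps)
  also have "\<dots> \<longleftrightarrow> A \<omega> - 1 / 2 \<le> (x + G - 1 / 2) / (1 + 2 * \<theta> * H)"
    using pos by (simp add: pos_le_divide_eq)
  also have "\<dots> \<longleftrightarrow> A \<omega> \<le> cost_threshold \<theta> (x, y, z)"
    by (auto simp: cost_threshold_def G_def H_def algebra_simps)
  finally show ?case .
qed

text \<open>
  Almost surely the number of periods with performance is an integer combination of indicators
  of lower orthants, whose probabilities are values of the copula: \<open>1[A \<le> t]\<close> for period 1,
  \<open>1[A \<le> t, B \<le> z]\<close> and \<open>1[B \<le> y] - 1[A \<le> t, B \<le> y]\<close> for period 2.
\<close>
lemma overall_performance_fgm:
  fixes x y z :: real
  assumes fgm: "fgm_distributed M A B \<theta>" and \<theta>: "\<bar>\<theta>\<bar> \<le> 1" and yz: "0 \<le> y" "0 \<le> z"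
  defines "t \<equiv> clamp01 (cost_threshold \<theta> (x, y, z))"
  shows "overall_performance M A B (x, y, z) =
    t + clamp01 y + fgm_copula \<theta> t (clamp01 z) - fgm_copula \<theta> t (clamp01 y)"
proof -
  from fgm interpret prob_space M by (simp add: fgm_distributed_def)
  have [measurable]: "A \<in> borel_measurable M" "B \<in> borel_measurable M"
    using fgm by (auto simp: fgm_distributed_def)
  define \<tau> where "\<tau> = cost_threshold \<theta> (x, y, z)"
  define E where "E a b = {\<omega> \<in> space M. A \<omega> \<le> a \<and> B \<omega> \<le> b}" for a b
  have [measurable]: "E a b \<in> events" for a b
    unfolding E_def by measurable
  have prob_E: "prob (E a b) = fgm_copula \<theta> (clamp01 a) (clamp01 b)" for a b
    unfolding E_def by (rule fgm_distributed_cdf[OF fgm])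
  have [measurable]: "continuation_value M A B r \<in> borel_measurable M" for r
    unfolding continuation_value_def by measurable
  have [measurable]: "Measurable.pred M (performs1 M A B (x, y, z))"
    unfolding performs1.simps by measurable
  have [measurable]: "Measurable.pred M (performs2 M A B (x, y, z))"
    unfolding performs2.simps by measurable
  \<comment> \<open>The bound \<open>1\<close> in \<open>E \<tau> 1\<close> and \<open>E 1 y\<close> stands for no constraint: almost surely both costs are at most \<open>1\<close>.\<close>
  have "AE \<omega> in M. of_bool (performs1 M A B (x, y, z) \<omega>) + of_bool (performs2 M A B (x, y, z) \<omega>) =
      indicator (E \<tau> 1) \<omega> + indicator (E 1 y) \<omega> + indicator (E \<tau> z) \<omega> - (indicator (E \<tau> y) \<omega> :: real)"
    using performs1_iff_cost_threshold[OF fgm \<theta> yz, of x] fgm_distributed_AE_unit[OF fgm] AE_space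
    by eventually_elim (auto simp: E_def \<tau>_def indicator_def)
  then have "overall_performance M A B (x, y, z) =
      (\<integral>\<omega>. indicator (E \<tau> 1) \<omega> + indicator (E 1 y) \<omega> + indicator (E \<tau> z) \<omega> - indicator (E \<tau> y) \<omega> \<partial>M)"
    unfolding overall_performance_def by (intro integral_cong_AE) measurable
  also have "\<dots> = prob (E \<tau> 1) + prob (E 1 y) + prob (E \<tau> z) - prob (E \<tau> y)"
    by (simp add: integrable_real_indicator emeasure_eq_measure)
  also have "\<dots> = t + clamp01 y + fgm_copula \<theta> t (clamp01 z) - fgm_copula \<theta> t (clamp01 y)"
    unfolding prob_E t_def \<tau>_def by (simp add: fgm_copula_def clamp01_def[of 1])
  finally show ?thesis .
qed

section \<open>The effect of the dependence parameter\<close>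

text \<open>
  The threshold decreases in \<open>\<theta>\<close>, since its numerator is at most \<open>0\<close> and its denominator
  \<open>1 - 2\<theta> h(w)\<close> decreases. Performance loses \<open>t - t'\<close> in period 1 and regains in period 2 at most
  as much, by nonexpansiveness of the copula; a larger \<open>\<theta>\<close> lowers it further at a given threshold.
\<close>
lemma sufficient_performance_antimono:
  assumes "0 \<le> w" "\<bar>\<theta>\<bar> \<le> 1" "\<bar>\<theta>'\<bar> \<le> 1" "\<theta> \<le> \<theta>'"
    and "fgm_distributed M A B \<theta>" "fgm_distributed N A' B' \<theta>'"
  shows "overall_performance N A' B' (purely_sufficient w) \<le> overall_performance M A B (purely_sufficient w)"
proof -
  define t where "t \<theta> = clamp01 (cost_threshold \<theta> (w, w, 0))" for \<theta>
  have perf: "overall_performance M A B (purely_sufficient w) = t \<theta> + clamp01 w - fgm_copula \<theta> (t \<theta>) (clamp01 w)"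
    if "\<bar>\<theta>\<bar> \<le> 1" "fgm_distributed M A B \<theta>" for M A B \<theta>
    using overall_performance_fgm[OF that(2,1), of w 0 w] assms(1)
    by (simp add: purely_sufficient_def t_def fgm_copula_def clamp01_def[of 0])
  have "w - surplus_mean w \<le> 1 / 2"
    using zero_le_power2[of "1 - w"] by (auto simp: surplus_mean_def power2_eq_square algebra_simps)
  then have "cost_threshold \<theta>' (w, w, 0) \<le> cost_threshold \<theta> (w, w, 0)"
    unfolding cost_threshold_def prod.case
    using assms surplus_tilt_bounds[of w] cost_threshold_denominator_pos[of _ w 0]
    by (intro add_left_mono divide_left_mono_neg)
       (auto simp: surplus_tilt_def[of 0] surplus_mean_def[of 0] intro!: mult_right_mono mult_pos_pos)
  then have "t \<theta>' \<le> t \<theta>" by (simp add: t_def clamp01_mono)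
  then have "fgm_copula \<theta> (t \<theta>) (clamp01 w) - fgm_copula \<theta> (t \<theta>') (clamp01 w) \<le> t \<theta> - t \<theta>'"
    using assms by (intro fgm_copula_nonexpansive_arg) (auto simp: t_def)
  moreover have "fgm_copula \<theta> (t \<theta>') (clamp01 w) \<le> fgm_copula \<theta>' (t \<theta>') (clamp01 w)"
    using assms by (intro fgm_copula_mono_param) (auto simp: t_def)
  ultimately show ?thesis
    using perf[OF assms(2,5)] perf[OF assms(3,6)] by linarith
qed

lemma sustained_performance_fgm:
  assumes "0 \<le> w" "\<bar>\<theta>\<bar> \<le> 1" "fgm_distributed M A B \<theta>"
  shows "overall_performance M A B (purely_sustained w) =
    clamp01 (cost_threshold \<theta> (0, 0, w)) + fgm_copula \<theta> (clamp01 (cost_threshold \<theta> (0, 0, w))) (clamp01 w)"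
  using overall_performance_fgm[OF assms(3,2), of 0 w 0] assms(1)
  by (simp add: purely_sustained_def fgm_copula_def clamp01_def[of 0])

text \<open>
  Here the denominator \<open>1 + 2\<theta> h(w)\<close> increases in \<open>\<theta>\<close>, which pulls the threshold towards
  \<open>1/2\<close>. For \<open>w \<le> 1\<close> it approaches \<open>1/2\<close> from below.
\<close>
lemma sustained_performance_mono:
  assumes "0 \<le> w" "w \<le> 1" "\<bar>\<theta>\<bar> \<le> 1" "\<bar>\<theta>'\<bar> \<le> 1" "\<theta> \<le> \<theta>'"
    and "fgm_distributed M A B \<theta>" "fgm_distributed N A' B' \<theta>'"
  shows "overall_performance M A B (purely_sustained w) \<le> overall_performance N A' B' (purely_sustained w)"
proof -
  define t where "t \<theta> = clamp01 (cost_threshold \<theta> (0, 0, w))" for \<theta>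
  have "surplus_mean w \<le> 1 / 2"
    using assms by (auto simp: surplus_mean_def power_le_one)
  then have "cost_threshold \<theta> (0, 0, w) \<le> cost_threshold \<theta>' (0, 0, w)"
    unfolding cost_threshold_def prod.case
    using assms surplus_tilt_bounds[of w] cost_threshold_denominator_pos[of _ 0 w]
    by (intro add_left_mono divide_left_mono_neg)
       (auto simp: surplus_tilt_def[of 0] surplus_mean_def[of 0] intro!: mult_right_mono mult_pos_pos)
  then have t: "t \<theta> \<le> t \<theta>'" by (simp add: t_def clamp01_mono)
  have "fgm_copula \<theta> (t \<theta>) (clamp01 w) \<le> fgm_copula \<theta> (t \<theta>') (clamp01 w)"
    using assms t by (intro fgm_copula_mono_arg) (auto simp: t_def)
  also have "\<dots> \<le> fgm_copula \<theta>' (t \<theta>') (clamp01 w)"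
    using assms by (intro fgm_copula_mono_param) (auto simp: t_def)
  finally show ?thesis
    using t sustained_performance_fgm[OF assms(1,3,6)] sustained_performance_fgm[OF assms(1,4,7)]
    by (simp add: t_def)
qed

text \<open>
  For \<open>w \<ge> 1\<close> the threshold approaches \<open>1/2\<close> from above; it may exceed \<open>1\<close>, where clamping makes
  the performance constant. The second argument of the copula is \<open>1\<close>, so its dependence on \<open>\<theta>\<close>
  disappears.
\<close>
lemma sustained_performance_antimono:
  assumes "1 \<le> w" "\<bar>\<theta>\<bar> \<le> 1" "\<bar>\<theta>'\<bar> \<le> 1" "\<theta> \<le> \<theta>'"
    and "fgm_distributed M A B \<theta>" "fgm_distributed N A' B' \<theta>'"
  shows "overall_performance N A' B' (purely_sustained w) \<le> overall_performance M A B (purely_sustained w)"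
proof -
  have "1 / 2 \<le> surplus_mean w"
    using assms by (auto simp: surplus_mean_def)
  then have "cost_threshold \<theta>' (0, 0, w) \<le> cost_threshold \<theta> (0, 0, w)"
    unfolding cost_threshold_def prod.case
    using assms surplus_tilt_bounds[of w] cost_threshold_denominator_pos[of _ 0 w]
    by (intro add_left_mono divide_left_mono)
       (auto simp: surplus_tilt_def[of 0] surplus_mean_def[of 0] intro!: mult_right_mono mult_pos_pos)
  then have "clamp01 (cost_threshold \<theta>' (0, 0, w)) \<le> clamp01 (cost_threshold \<theta> (0, 0, w))"
    by (rule clamp01_mono)
  moreover have "0 \<le> w" "clamp01 w = 1" using assms(1) by (auto simp: clamp01_def)
  ultimately show ?thesis
    using sustained_performance_fgm[of w \<theta> M A B] sustained_performance_fgm[of w \<theta>' N A' B'] assms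
    by (simp add: fgm_copula_def)
qed

theorem proposition2:
  fixes P :: "real \<Rightarrow> 'a measure" and A B :: "'a \<Rightarrow> real" and w :: real
  assumes "0 \<le> w" and "w < 3 / 2"
    and "\<And>\<theta>. \<theta> \<in> {-1..1} \<Longrightarrow> fgm_distributed (P \<theta>) A B \<theta>"
  shows "antimono_on {-1..1} (\<lambda>\<theta>. overall_performance (P \<theta>) A B (purely_sufficient w)) \<and>
    (w < 1 \<longrightarrow> mono_on {-1..1} (\<lambda>\<theta>. overall_performance (P \<theta>) A B (purely_sustained w))) \<and>
    (w > 1 \<longrightarrow> antimono_on {-1..1} (\<lambda>\<theta>. overall_performance (P \<theta>) A B (purely_sustained w)))"
proof (intro conjI impI monotone_onI)
  fix \<theta> \<theta>' :: real assume \<theta>: "\<theta> \<in> {-1..1}" "\<theta>' \<in> {-1..1}" "\<theta> \<le> \<theta>'"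
  then have abs: "\<bar>\<theta>\<bar> \<le> 1" "\<bar>\<theta>'\<bar> \<le> 1" by auto
  note fgm = assms(3)[OF \<theta>(1)] assms(3)[OF \<theta>(2)]
  show "overall_performance (P \<theta>') A B (purely_sufficient w) \<le> overall_performance (P \<theta>) A B (purely_sufficient w)"
    using sufficient_performance_antimono[OF assms(1) abs \<theta>(3) fgm] .
  show "overall_performance (P \<theta>) A B (purely_sustained w) \<le> overall_performance (P \<theta>') A B (purely_sustained w)"
    if "w < 1"
    using sustained_performance_mono[OF assms(1) _ abs \<theta>(3) fgm] that by simp
  show "overall_performance (P \<theta>') A B (purely_sustained w) \<le> overall_performance (P \<theta>) A B (purely_sustained w)"
    if "w > 1"
    using sustained_performance_antimono[OF _ abs \<theta>(3) fgm] that by simp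
qed

end
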